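(* There is an absolute constant $C>0$ such that the following holds. Let $n>m\ge 1$ be integers, let $q(z)=\sum_{k=0}^m c_k z^k$ be a polynomial of degree $m$ all of whose coefficients satisfy $|c_k|=1$ and with $q(0)=c_0=1$, and let $p(z)=z^n+q(z)$. Then the harmonic polynomial $p(z)+\overline{q(z)}$ has at most $C\,n^{3/2}$ zeros in $\mathbb{C}$.
   Context: A zero of $p+\overline{q}$ is a point $z\in\mathbb{C}$ with $p(z)+\overline{q(z)}=0$. *)

theory Defs
  imports "HOL-Analysis.Analysis"
begin

end

theory Submission
  imports Defs "HOL-Complex_Analysis.Complex_Analysis"
begin

text \<open>
  Since \<open>z ^ n = - 2 * Re (q z)\<close> is real, the zeros lie on the \<open>2 * n\<close> rays through the
  \<open>2 * n\<close>-th roots of unity. On each ray they are the positive roots of a polynomial \<open>f\<close> of degree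
  \<open>n\<close> with coefficients bounded by 2 and with lowest and leading coefficient of modulus at
  least 1, so it suffices that such an \<open>f\<close> has \<open>O (sqrt n)\<close> roots in \<open>(0, 1]\<close>; the roots
  beyond 1 are those of the reflected polynomial.

  On the unit disc \<open>norm (f z) \<le> 2 / (1 - norm z)\<close>. The map \<open>w \<mapsto> (w + w\<^sup>2) / 2\<close> sends the unit
  circle into the unit disc, touching its boundary only at 1 and there to second order; hence
  \<open>h w = f ((w + w\<^sup>2) / 2) * (1 - w)\<^sup>2\<close> is bounded by 16 on the unit circle, while
  \<open>h 0 = f 0\<close>. Let \<open>M\<close> be about \<open>sqrt n\<close>. Dividing out Blaschke factors, the maximum
  principle for \<open>h\<close> yields \<open>O (M)\<close> roots in \<open>(0, 1 - 1 / M]\<close>. The maximum principle for the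
  product of the \<open>M\<close> rotations of \<open>h\<close> yields a point at distance \<open>O (1 / M)\<close> from 1 where
  \<open>norm f\<close> is at least \<open>16 ^ -M / 4\<close>. As \<open>norm f\<close> is at most \<open>exp (O (M))\<close> on a disc of
  radius comparable to \<open>1 / M\<close> around this point, Jensen's inequality leaves \<open>O (M)\<close>
  roots in \<open>[1 - 1 / M, 1]\<close>.
\<close>

section \<open>Maximum principle on circles, with zeros and with rotations\<close>

lemma norm_poly_center_le:
  fixes f :: "complex poly"
  assumes "R > 0" "\<And>z. norm (z - c) = R \<Longrightarrow> norm (poly f z) \<le> B"
  shows "norm (poly f c) \<le> B"
proof (rule maximum_modulus_frontier[where S = "cball c R" and f = "poly f"])
  show "poly f holomorphic_on interior (cball c R)"
    by (intro holomorphic_intros)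
  show "continuous_on (closure (cball c R)) (poly f)"
    by (intro continuous_intros)
  show "norm (poly f z) \<le> B" if "z \<in> frontier (cball c R)" for z
    using that assms by (auto simp: frontier_cball dist_norm norm_minus_commute)
qed (use assms in auto)

lemma norm_poly_0_le_of_zeros_unit_disc:
  fixes f :: "complex poly"
  assumes "finite S" "0 \<le> r" "\<And>s. s \<in> S \<Longrightarrow> norm s \<le> r" "\<And>s. s \<in> S \<Longrightarrow> poly f s = 0"
    and "\<And>z. norm z = 1 \<Longrightarrow> norm (poly f z) \<le> B"
  shows "norm (poly f 0) \<le> B * r ^ card S"
  using assms(1,3-5)
proof (induction S arbitrary: f rule: finite_induct)
  case empty
  then show ?case using norm_poly_center_le[of 1 0 f B] by simp
next
  case (insert s S)
  have "poly f s = 0" using insert.prems by simp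
  then obtain u where u: "f = [:- s, 1:] * u"
    using poly_eq_0_iff_dvd[of f s] by (auto elim: dvdE)
  \<comment> \<open>Exchanging the factor \<open>z - s\<close> for \<open>1 - cnj s * z\<close> leaves the modulus on the unit circle
    unchanged, and multiplies the modulus at 0 by \<open>1 / norm s\<close>.\<close>
  define g where "g = [:1, - cnj s:] * u"
  have "norm (poly g 0) \<le> B * r ^ card S"
  proof (rule insert.IH)
    show "poly g t = 0" if "t \<in> S" for t
    proof -
      have "poly f t = 0" "t \<noteq> s" using that insert by auto
      then have "poly u t = 0" by (simp add: u)
      then show ?thesis by (simp add: g_def)
    qed
    show "norm (poly g z) \<le> B" if z: "norm z = 1" for z
    proof -
      have "z * cnj z = 1" using z by (simp add: complex_norm_square[symmetric])
      then have "1 - cnj s * z = z * cnj (z - s)" by (simp add: algebra_simps)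
      then have "norm (1 - cnj s * z) = norm (z - s)" using z by (simp only: norm_mult complex_mod_cnj mult_1)
      moreover have "poly g z = (1 - cnj s * z) * poly u z" "poly f z = (z - s) * poly u z"
        by (simp_all add: g_def u algebra_simps)
      ultimately have "norm (poly g z) = norm (poly f z)" by (simp add: norm_mult)
      then show ?thesis using insert.prems z by simp
    qed
  qed (use insert.prems in auto)
  moreover have "norm (poly f 0) = norm s * norm (poly g 0)"
    by (simp add: u g_def norm_mult)
  moreover have "norm s \<le> r" using insert.prems by simp
  ultimately have "norm (poly f 0) \<le> r * (B * r ^ card S)"
    using assms(2) by (simp add: mult_mono)
  then show ?case using insert.hyps by (simp add: mult_ac)
qed

text \<open>Jensen's inequality in product form: the unit disc case after the substitution
  \<open>z = c + R * w\<close>.\<close>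

lemma norm_poly_center_le_of_zeros:
  fixes f :: "complex poly"
  assumes "finite S" "0 < R" "0 \<le> r" "\<And>s. s \<in> S \<Longrightarrow> norm (s - c) \<le> r" "\<And>s. s \<in> S \<Longrightarrow> poly f s = 0"
    and "\<And>z. norm (z - c) = R \<Longrightarrow> norm (poly f z) \<le> B"
  shows "norm (poly f c) \<le> B * (r / R) ^ card S"
proof -
  define g where "g = f \<circ>\<^sub>p [:c, of_real R:]"
  define T where "T = (\<lambda>s. (s - c) / of_real R) ` S"
  have "card T = card S"
    unfolding T_def using assms(2) by (intro card_image) (auto simp: inj_on_def)
  moreover have "norm (poly g 0) \<le> B * (r / R) ^ card T"
  proof (rule norm_poly_0_le_of_zeros_unit_disc)
    show "norm (poly g z) \<le> B" if "norm z = 1" for z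
      using assms(6)[of "c + of_real R * z"] that assms(2)
      by (simp add: g_def poly_pcompose norm_mult mult.commute)
  qed (use assms in \<open>auto simp: T_def g_def poly_pcompose norm_divide divide_right_mono\<close>)
  ultimately show ?thesis by (simp add: g_def poly_pcompose)
qed

text \<open>The product \<open>H\<close> of the \<open>M\<close> rotations of \<open>h\<close> has
  the value \<open>poly h 0 ^ M\<close> at 0. On the unit circle one factor is at most \<epsilon>
  and the other \<open>M - 1\<close> are at most \<open>B\<close>, so the maximum principle for
  \<open>H\<close> gives the bound.\<close>

lemma norm_poly_0_power_le_of_small_near_1:
  fixes h :: "complex poly"
  assumes "M > 0" "B \<ge> 0" and B: "\<And>w. norm w = 1 \<Longrightarrow> norm (poly h w) \<le> B"
    and eps: "\<And>w. norm w = 1 \<Longrightarrow> norm (w - 1) \<le> 2 * pi / real M \<Longrightarrow> norm (poly h w) \<le> \<epsilon>"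
  shows "norm (poly h 0) ^ M \<le> \<epsilon> * B ^ (M - 1)"
proof -
  \<comment> \<open>Among the rotations of a point of the unit circle by the \<open>M\<close>-th roots of unity, one
    lies in the arc where \<open>h\<close> is small.\<close>
  define \<zeta> where "\<zeta> = (\<lambda>j::nat. cis (- (2 * pi * real j / real M)))"
  define H where "H = (\<Prod>j<M. h \<circ>\<^sub>p [:0, \<zeta> j:])"
  have H: "poly H w = (\<Prod>j<M. poly h (\<zeta> j * w))" for w
    by (simp add: H_def poly_prod poly_pcompose mult.commute)
  have "norm (poly H w) \<le> \<epsilon> * B ^ (M - 1)" if w: "norm w = 1" for w
  proof -
    obtain t where t: "0 \<le> t" "t < 2 * pi" "w = cis t"
      using w Arg2pi_ge_0 Arg2pi_lt_2pi Arg2pi_eq[of w] by (auto simp: cis_conv_exp)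
    \<comment> \<open>\<open>x\<close> is the angle of \<open>w\<close> in units of
      \<open>2 * pi / M\<close>; rotating back by its integer part \<open>j\<close> leaves an angle
      in \<open>[0, 2 * pi / M)\<close>.\<close>
    define x where "x = t * real M / (2 * pi)"
    define j where "j = nat \<lfloor>x\<rfloor>"
    have x: "0 \<le> x" "x < real M" "t = 2 * pi * x / real M" using t assms(1)
      by (auto simp: x_def field_simps)
    have j: "real j \<le> x" "x < real j + 1" using x(1) by (auto simp: j_def)
    then have jM: "j < M" using x by linarith
    have "\<zeta> j * w = cis (2 * pi * (x - real j) / real M)"
      unfolding \<zeta>_def t(3) cis_mult x(3) by (simp add: diff_divide_distrib algebra_simps)
    \<comment> \<open>A chord is at most as long as its arc.\<close>
    moreover have "norm (cis s - 1) \<le> \<bar>s\<bar>" for s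
      using dist_exp_i_1[of s] abs_sin_x_le_abs_x[of "s/2"] by (simp add: cis_conv_exp)
    ultimately have "norm (\<zeta> j * w - 1) \<le> \<bar>2 * pi * (x - real j) / real M\<bar>" by metis
    also have "\<dots> = 2 * pi * (x - real j) / real M" using j by simp
    also have "\<dots> \<le> 2 * pi * 1 / real M" using j
      by (intro divide_right_mono mult_left_mono) auto
    finally have *: "norm (poly h (\<zeta> j * w)) \<le> \<epsilon>"
      using w by (intro eps) (auto simp: norm_mult \<zeta>_def)
    have "norm (poly H w) = norm (poly h (\<zeta> j * w)) * (\<Prod>i\<in>{..<M} - {j}. norm (poly h (\<zeta> i * w)))"
      unfolding H prod_norm[symmetric] using jM by (subst prod.remove[of _ j]) auto
    also have "(\<Prod>i\<in>{..<M} - {j}. norm (poly h (\<zeta> i * w))) \<le> (\<Prod>i\<in>{..<M} - {j}. B)"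
      using w by (intro prod_mono) (auto simp: norm_mult \<zeta>_def intro!: B)
    also have "\<dots> = B ^ (M - 1)" using jM by simp
    finally show ?thesis using *
      by (smt (verit) mult_left_mono mult_right_mono norm_ge_zero zero_le_power assms(2))
  qed
  then have "norm (poly H 0) \<le> \<epsilon> * B ^ (M - 1)"
    using norm_poly_center_le[of 1 0 H] by simp
  then show ?thesis by (simp add: H norm_power)
qed

section \<open>Coefficient bounds and the substitution \<open>(w + w^2) / 2\<close>\<close>

lemma norm_poly_le_sum:
  fixes f :: "complex poly"
  assumes "degree f \<le> n" "\<And>k. norm (coeff f k) \<le> A"
  shows "norm (poly f z) \<le> A * (\<Sum>k\<le>n. norm z ^ k)"
proof -
  have "poly f z = (\<Sum>k\<le>n. coeff f k * z ^ k)"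
    unfolding poly_altdef using assms(1) by (intro sum.mono_neutral_left) (auto simp: coeff_eq_0)
  also have "norm \<dots> \<le> (\<Sum>k\<le>n. A * norm z ^ k)"
    by (intro sum_norm_le) (auto simp: norm_mult norm_power intro!: mult_right_mono assms)
  finally show ?thesis by (simp add: sum_distrib_left)
qed

text \<open>Comparison with a geometric series. The product form also covers
  \<open>norm z = 1\<close>, which occurs below at \<open>w = 1\<close>.\<close>

lemma norm_poly_mult_one_minus_norm_le:
  fixes f :: "complex poly"
  assumes "\<And>k. norm (coeff f k) \<le> A" "norm z \<le> 1"
  shows "norm (poly f z) * (1 - norm z) \<le> A"
proof -
  have A: "A \<ge> 0" using assms(1)[of 0] norm_ge_zero order_trans by blast
  have "norm (poly f z) * (1 - norm z) \<le> A * (\<Sum>k\<le>degree f. norm z ^ k) * (1 - norm z)"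
    using assms by (intro mult_right_mono norm_poly_le_sum) auto
  also have "(\<Sum>k\<le>degree f. norm z ^ k) * (1 - norm z) = 1 - norm z ^ Suc (degree f)"
    using one_diff_power_eq[of "norm z" "Suc (degree f)"]
    by (simp only: lessThan_Suc_atMost mult.commute)
  then have "A * (\<Sum>k\<le>degree f. norm z ^ k) * (1 - norm z) = A * (1 - norm z ^ Suc (degree f))"
    by (simp only: mult.assoc)
  also have "\<dots> \<le> A * 1" using A by (intro mult_left_mono) auto
  finally show ?thesis by simp
qed

lemma poly_compose_mult_one_minus_power2:
  fixes f :: "complex poly"
  shows "poly ((f \<circ>\<^sub>p [:0, 1/2, 1/2:]) * [:1, -1:]^2) w = poly f ((w + w^2) / 2) * (1 - w)^2"
proof -
  have "poly [:0, 1/2, 1/2:] w = (w + w^2) / 2"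
    by (simp add: power2_eq_square algebra_simps add_divide_distrib)
  moreover have "poly [:1, -1:] w = 1 - w" by simp
  ultimately show ?thesis by (simp only: poly_mult poly_power poly_pcompose)
qed

text \<open>By the parallelogram law \<open>norm (1 - w)^2 = 4 * (1 - norm z ^ 2)\<close> for
  \<open>z = (w + w^2) / 2\<close>, which is at most \<open>8 * (1 - norm z)\<close>. So the factor
  \<open>(1 - w)^2\<close> absorbs the growth \<open>2 / (1 - norm z)\<close> of \<open>f\<close>,
  and \<open>16 = 8 * 2\<close>.\<close>

lemma norm_poly_compose_circle_le:
  fixes f :: "complex poly"
  assumes "\<And>k. norm (coeff f k) \<le> 2" "norm w = 1"
  shows "norm (poly ((f \<circ>\<^sub>p [:0, 1/2, 1/2:]) * [:1, -1:]^2) w) \<le> 16"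
proof -
  define z where "z = (w + w^2) / 2"
  have "z = w * (1 + w) / 2" by (simp add: z_def power2_eq_square algebra_simps)
  then have "norm z = norm (w * (1 + w) / 2)" by (simp only:)
  then have z: "norm z = norm (1 + w) / 2" using assms(2) by (simp add: norm_mult norm_divide)
  have "norm (1 + w) \<le> 2" using norm_triangle_ineq[of 1 w] assms(2) by simp
  then have z1: "norm z \<le> 1" using z by simp
  have "norm (1 - w) ^ 2 = 4 - norm (1 + w) ^ 2"
    using cmod_power2[of w] unfolding assms(2) cmod_power2 by (simp add: power2_eq_square algebra_simps)
  also have "\<dots> = 4 * (1 - norm z) * (1 + norm z)"
    unfolding z by (simp add: power2_eq_square field_simps)
  also have "\<dots> \<le> 4 * (1 - norm z) * 2" using z1 by (intro mult_left_mono) auto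
  finally have "norm (1 - w) ^ 2 \<le> 8 * (1 - norm z)" by simp
  then have "norm (poly f z) * norm (1 - w) ^ 2 \<le> norm (poly f z) * (8 * (1 - norm z))"
    by (rule mult_left_mono) auto
  also have "\<dots> \<le> 16" using norm_poly_mult_one_minus_norm_le[OF assms(1) z1] by (simp add: algebra_simps)
  finally show ?thesis
    by (simp only: poly_compose_mult_one_minus_power2 norm_mult norm_power z_def)
qed

section \<open>Counting roots in the unit interval\<close>

lemma card_zeros_away_from_1:
  fixes f :: "complex poly"
  assumes co: "\<And>k. norm (coeff f k) \<le> 2" and c0: "norm (coeff f 0) \<ge> 1" and M: "M > 0"
    and S: "finite S" "\<And>x. x \<in> S \<Longrightarrow> 0 < x \<and> x \<le> 1 - 1 / real M \<and> poly f (of_real x) = 0"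
  shows "card S \<le> 6 * M"
proof -
  define h where "h = (f \<circ>\<^sub>p [:0, 1/2, 1/2:]) * [:1, -1:]^2"
  \<comment> \<open>The nonnegative solution \<open>w\<close> of \<open>(w + w^2) / 2 = x\<close>;
    it turns roots of \<open>f\<close> into roots of \<open>h\<close>.\<close>
  define \<psi> where "\<psi> = (\<lambda>x::real. (sqrt (1 + 8 * x) - 1) / 2)"
  have \<psi>: "(\<psi> x + \<psi> x ^ 2) / 2 = x" "0 \<le> \<psi> x" if "0 < x" for x
    using that by (auto simp: \<psi>_def power2_eq_square field_simps)
  have \<psi>le: "\<psi> x \<le> 1 - 2 / (3 * real M)" if "x \<in> S" for x
  proof -
    have x: "0 < x" "x \<le> 1 - 1 / real M" using S(2)[OF that] by auto
    \<comment> \<open>Since \<open>2 + \<psi> x\<close> is at most 3, the pullback shrinks the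
      distance to 1 by a factor of at worst 2/3.\<close>
    have "2 * (1 - x) = (1 - \<psi> x) * (2 + \<psi> x)"
      using \<psi>(1)[OF x(1)] by (simp add: power2_eq_square algebra_simps)
    moreover have "1 - x > 0" using x M by (smt (verit) divide_pos_pos of_nat_0_less_iff)
    ultimately have "1 - \<psi> x > 0" using \<psi>(2)[OF x(1)] by (smt (verit) mult_nonpos_nonneg)
    then have "(1 - \<psi> x) * (2 + \<psi> x) \<le> (1 - \<psi> x) * 3" by (intro mult_left_mono) auto
    then have "2 * (1 - x) \<le> (1 - \<psi> x) * 3" using \<open>2 * (1 - x) = _\<close> by simp
    then show ?thesis using x(2) by (simp add: field_simps)
  qed
  define T where "T = (\<lambda>x. complex_of_real (\<psi> x)) ` S"
  define r where "r = 1 - 2 / (3 * real M)"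
  have "2 / (3 * real M) \<le> 1" using M by (simp add: field_simps)
  then have r0: "0 \<le> r" by (simp add: r_def)
  have "inj_on (\<lambda>x. complex_of_real (\<psi> x)) S"
    using \<psi>(1) S(2) by (intro inj_onI) (metis of_real_eq_iff)
  then have cT: "card T = card S" unfolding T_def by (rule card_image)
  have "norm (poly h 0) \<le> 16 * r ^ card T"
  proof (rule norm_poly_0_le_of_zeros_unit_disc)
    show "norm s \<le> r" if "s \<in> T" for s
      using that \<psi>le \<psi>(2) S(2) by (auto simp: T_def r_def)
    show "poly h s = 0" if s: "s \<in> T" for s
    proof -
      obtain x where x: "x \<in> S" "s = of_real (\<psi> x)" using s by (auto simp: T_def)
      then have "complex_of_real ((\<psi> x + \<psi> x ^ 2) / 2) = of_real x"
        using \<psi>(1) S(2) by simp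
      then have "poly [:0, 1/2, 1/2:] s = of_real x"
        unfolding x(2) by (simp add: power2_eq_square algebra_simps add_divide_distrib)
      then show ?thesis using S(2)[OF x(1)] by (simp add: h_def poly_pcompose del: poly_pCons)
    qed
    show "norm (poly h z) \<le> 16" if "norm z = 1" for z
      unfolding h_def using co that by (rule norm_poly_compose_circle_le)
  qed (use S r0 in \<open>auto simp: T_def\<close>)
  moreover have "norm (poly h 0) = norm (coeff f 0)"
    by (simp add: h_def poly_pcompose flip: poly_0_coeff_0)
  ultimately have 1: "1 \<le> 16 * r ^ card S" using c0 cT by simp
  have "r \<le> exp (- (2 / (3 * real M)))" using exp_ge_add_one_self[of "- (2 / (3 * real M))"]
    by (simp add: r_def)
  then have "r ^ card S \<le> exp (- (2 / (3 * real M))) ^ card S" using r0 by (rule power_mono)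
  also have "\<dots> = exp (- (2 * real (card S) / (3 * real M)))"
    by (simp add: exp_of_nat_mult[symmetric])
  finally have "1 \<le> 16 * exp (- (2 * real (card S) / (3 * real M)))" using 1 by linarith
  then have "exp (2 * real (card S) / (3 * real M)) \<le> 16" by (simp add: exp_minus field_simps)
  \<comment> \<open>\<open>exp 1 \<ge> 2\<close> gives \<open>16 \<le> exp 4\<close>; the exponent 4
    yields the constant \<open>6 = 4 * 3 / 2\<close>.\<close>
  also have "(16::real) = 2 ^ 4" by simp
  also have "\<dots> \<le> exp 1 ^ 4" using exp_ge_add_one_self[of 1] by (intro power_mono) auto
  also have "\<dots> = exp 4" by (simp add: exp_of_nat_mult[symmetric])
  finally have "2 * real (card S) / (3 * real M) \<le> 4" by simp
  then have "real (card S) \<le> real (6 * M)" using M by (simp add: field_simps)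
  then show ?thesis by (simp only: of_nat_le_iff)
qed

text \<open>The assumption \<open>n \<le> M ^ 2\<close> makes \<open>(1 + 24 / M) ^ n\<close> at
  most \<open>exp (24 * M)\<close>, so at distance \<open>O (1 / M)\<close> outside the unit disc
  the upper bound for \<open>f\<close> is of the same exponential order in \<open>M\<close> as the
  lower bound at the chosen center.\<close>

lemma card_zeros_near_1:
  fixes f :: "complex poly"
  assumes deg: "degree f \<le> n" "n \<le> M ^ 2"
    and co: "\<And>k. norm (coeff f k) \<le> 2" and c0: "norm (coeff f 0) \<ge> 1" and M: "M > 0"
    and S: "finite S" "\<And>x. x \<in> S \<Longrightarrow> 1 - 1 / real M \<le> x \<and> x \<le> 1 \<and> poly f (of_real x) = 0"
  shows "card S \<le> 58 * M"
proof -
  define h where "h = (f \<circ>\<^sub>p [:0, 1/2, 1/2:]) * [:1, -1:]^2"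
  \<comment> \<open>If \<open>h\<close> stayed below \<open>(1/16) ^ M\<close> on this arc, the
    rotation lemma would force \<open>norm (poly h 0) ^ M\<close> below 1.\<close>
  have "\<exists>w. norm w = 1 \<and> norm (w - 1) \<le> 2 * pi / real M \<and> (1/16) ^ M \<le> norm (poly h w)"
  proof (rule ccontr)
    assume neg: "\<not> ?thesis"
    have "norm (poly h 0) ^ M \<le> (1/16) ^ M * 16 ^ (M - 1)"
    proof (rule norm_poly_0_power_le_of_small_near_1[OF M])
      show "norm (poly h w) \<le> 16" if "norm w = 1" for w
        unfolding h_def using co that by (rule norm_poly_compose_circle_le)
    qed (use neg in force)+
    also have "\<dots> < (1/16) ^ M * 16 ^ M" using M by (intro mult_strict_left_mono power_strict_increasing) auto
    also have "\<dots> = 1" by (simp add: power_mult_distrib[symmetric])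
    finally have "norm (poly h 0) ^ M < 1" .
    moreover have "norm (poly h 0) \<ge> 1"
      using c0 by (simp add: h_def poly_pcompose flip: poly_0_coeff_0)
    ultimately show False using one_le_power not_less by blast
  qed
  then obtain w where w: "norm w = 1" "norm (w - 1) \<le> 2 * pi / real M" "(1/16) ^ M \<le> norm (poly h w)"
    by blast
  define z where "z = (w + w^2) / 2"
  have "norm (w + w^2) \<le> 2" using norm_triangle_ineq[of w "w^2"] w(1) by (simp add: norm_power)
  then have z1: "norm z \<le> 1" by (simp add: z_def norm_divide)
  have "norm (w + 2) \<le> 3" using norm_triangle_ineq[of w 2] w(1) by simp
  have "z - 1 = (w - 1) * (w + 2) / 2" by (simp add: z_def power2_eq_square field_simps)
  then have "norm (z - 1) = norm ((w - 1) * (w + 2) / 2)" by (simp only:)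
  also have "\<dots> = norm (w - 1) * norm (w + 2) / 2" by (simp add: norm_mult norm_divide)
  also have "\<dots> \<le> (2 * pi / real M) * 3 / 2"
    using w(2) \<open>norm (w + 2) \<le> 3\<close> by (intro divide_right_mono mult_mono) auto
  also have "\<dots> \<le> 11 / real M" using pi_less_4 pi_approx M by (simp add: field_simps)
  finally have zd: "norm (z - 1) \<le> 11 / real M" .
  have "norm (1 - w) ^ 2 \<le> 2 ^ 2" using norm_triangle_ineq4[of 1 w] w(1) by (intro power_mono) auto
  then have "norm (poly f z) * norm (1 - w) ^ 2 \<le> norm (poly f z) * 4" by (intro mult_left_mono) auto
  moreover have "norm (poly h w) = norm (poly f z) * norm (1 - w) ^ 2"
    by (simp add: h_def poly_compose_mult_one_minus_power2 norm_mult norm_power z_def del: poly_mult)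
  ultimately have low: "(1/16) ^ M \<le> 4 * norm (poly f z)" using w(3) by simp
  \<comment> \<open>All roots in \<open>S\<close> lie within \<open>1 / M + 11 / M = 12 / M\<close>
    of \<open>z\<close>. On the circle of twice that radius, \<open>B\<close> bounds
    \<open>f\<close> through its \<open>n + 1\<close> terms; the ratio of the radii gives a factor
    1/2 per root.\<close>
  define B where "B = 2 * (real (n + 1) * (1 + 24 / real M) ^ n)"
  have "norm (poly f z) \<le> B * ((12 / real M) / (24 / real M)) ^ card (complex_of_real ` S)"
  proof (rule norm_poly_center_le_of_zeros)
    show "norm (s - z) \<le> 12 / real M" if s: "s \<in> complex_of_real ` S" for s
    proof -
      obtain x where x: "x \<in> S" "s = of_real x" using s by auto
      have "norm (s - 1) = \<bar>x - 1\<bar>" unfolding x(2) by (metis norm_of_real of_real_1 of_real_diff)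
      also have "\<dots> \<le> 1 / real M" using S(2)[OF x(1)] by auto
      finally have "norm (s - 1) \<le> 1 / real M" .
      then have "norm (s - z) \<le> 1 / real M + 11 / real M"
        using zd norm_triangle_ineq4[of "s - 1" "z - 1"] by simp
      then show ?thesis by (simp add: add_divide_distrib[symmetric])
    qed
    show "norm (poly f y) \<le> B" if y: "norm (y - z) = 24 / real M" for y
    proof -
      have ny: "norm y \<le> 1 + 24 / real M" using norm_triangle_ineq[of "y - z" z] y z1 by simp
      have "norm (poly f y) \<le> 2 * (\<Sum>k\<le>n. norm y ^ k)"
        using deg(1) co by (rule norm_poly_le_sum)
      also have "(\<Sum>k\<le>n. norm y ^ k) \<le> (\<Sum>k\<le>n. (1 + 24 / real M) ^ n)"
      proof (rule sum_mono)
        fix k assume "k \<in> {..n}"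
        have "norm y ^ k \<le> (1 + 24 / real M) ^ k" using ny by (intro power_mono) auto
        also have "\<dots> \<le> (1 + 24 / real M) ^ n" using \<open>k \<in> {..n}\<close> by (intro power_increasing) auto
        finally show "norm y ^ k \<le> (1 + 24 / real M) ^ n" .
      qed
      finally show ?thesis by (simp add: B_def)
    qed
  qed (use S M in auto)
  moreover have "card (complex_of_real ` S) = card S" by (intro card_image) (auto simp: inj_on_def)
  moreover have "(12 / real M) / (24 / real M) = 1 / 2" using M by simp
  ultimately have "norm (poly f z) \<le> B * (1 / 2) ^ card S" by (simp only:)
  then have up: "norm (poly f z) * 2 ^ card S \<le> B" by (simp add: power_divide field_simps)
  \<comment> \<open>Every bound is now turned into a power of 2, so that the final comparison is one
    of exponents.\<close>
  have "(1 + 24 / real M) ^ n \<le> (1 + 24 / real M) ^ (M ^ 2)" using deg(2) by (intro power_increasing) auto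
  also have "\<dots> \<le> exp (24 / real M) ^ (M ^ 2)"
    using exp_ge_add_one_self[of "24 / real M"] by (intro power_mono) auto
  also have "\<dots> = exp (24 * real M)"
    using M by (simp add: exp_of_nat_mult[symmetric] power2_eq_square)
  also have "\<dots> = exp 1 ^ (24 * M)" by (simp add: exp_of_nat_mult[symmetric])
  also have "\<dots> \<le> (4::real) ^ (24 * M)" using exp_le by (intro power_mono) auto
  also have "(4::real) ^ (24 * M) = (2 ^ 2) ^ (24 * M)" by simp
  also have "\<dots> = 2 ^ (48 * M)" by (simp only: power_mult[symmetric]) simp
  finally have e: "(1 + 24 / real M) ^ n \<le> 2 ^ (48 * M)" .
  \<comment> \<open>Strictness here absorbs the \<open>+ 1\<close> in \<open>n + 1\<close>.\<close>
  have "M < 2 ^ M" by (rule less_exp)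
  then have "M ^ 2 + 1 \<le> (2 ^ M) ^ 2" using power_strict_mono[of M "2 ^ M" 2] by simp
  then have "n + 1 \<le> 2 ^ (2 * M)" using deg(2) by (simp add: power_mult[symmetric] mult.commute)
  then have "real (n + 1) \<le> 2 ^ (2 * M)" by (metis of_nat_le_iff of_nat_numeral of_nat_power)
  then have "B \<le> 2 * (2 ^ (2 * M) * 2 ^ (48 * M))" unfolding B_def using e
    by (intro mult_left_mono mult_mono) auto
  also have "\<dots> = 2 ^ (50 * M + 1)" by (simp add: power_add[symmetric])
  finally have B: "B \<le> 2 ^ (50 * M + 1)" .
  have "(16::real) ^ M = (2 ^ 4) ^ M" by simp
  also have "\<dots> = 2 ^ (4 * M)" by (simp only: power_mult)
  finally have "(1/16::real) ^ M * 2 ^ (4 * M) = 1" by (simp add: power_divide)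
  \<comment> \<open>Exponents: \<open>4 * M\<close> from the lower bound for \<open>h\<close>, 2
    from the factor 4, and \<open>50 * M + 1\<close> from \<open>B\<close>.\<close>
  then have "(2::real) ^ card S = (1/16::real) ^ M * 2 ^ (4 * M) * 2 ^ card S" by simp
  also have "\<dots> \<le> (4 * norm (poly f z)) * 2 ^ (4 * M) * 2 ^ card S"
    using low by (intro mult_right_mono) auto
  also have "\<dots> = 4 * 2 ^ (4 * M) * (norm (poly f z) * 2 ^ card S)" by simp
  also have "\<dots> \<le> 4 * 2 ^ (4 * M) * 2 ^ (50 * M + 1)" using up B by (intro mult_left_mono) auto
  also have "\<dots> = 2 ^ (54 * M + 3)" by (simp add: power_add flip: power_add[of _ "_ * M" "_ * M"])
  finally have "card S \<le> 54 * M + 3" by (simp add: power_increasing_iff)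
  then show ?thesis using M by linarith
qed

lemma card_zeros_unit_interval:
  fixes f :: "complex poly"
  assumes n: "degree f \<le> n" "n > 0"
    and co: "\<And>k. norm (coeff f k) \<le> 2" and c0: "norm (coeff f 0) \<ge> 1"
  defines "Z \<equiv> {x::real. 0 < x \<and> x \<le> 1 \<and> poly f (of_real x) = 0}"
  shows "finite Z" "real (card Z) \<le> 128 * sqrt (real n)"
proof -
  have "f \<noteq> 0" using c0 by auto
  then have "finite {z. poly f z = 0}" by (rule poly_roots_finite)
  moreover have "complex_of_real ` Z \<subseteq> {z. poly f z = 0}" by (auto simp: Z_def)
  ultimately have "finite (complex_of_real ` Z)" by (rule rev_finite_subset)
  then show fin: "finite Z" by (rule finite_imageD) (auto simp: inj_on_def)
  \<comment> \<open>Rounding up ensures \<open>n \<le> M ^ 2\<close>, while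
    \<open>M \<le> 2 * sqrt n\<close> because \<open>n \<ge> 1\<close>; hence
    \<open>128 = 2 * (6 + 58)\<close>.\<close>
  define M where "M = nat \<lceil>sqrt (real n)\<rceil>"
  have s1: "sqrt (real n) \<ge> 1" using n by simp
  then have M: "sqrt (real n) \<le> real M" "real M \<le> sqrt (real n) + 1" by (auto simp: M_def)
  then have M0: "M > 0" using s1 by (cases M) auto
  have "sqrt (real n) ^ 2 \<le> real M ^ 2" using M(1) by (intro power_mono) auto
  then have "real n \<le> real (M ^ 2)" by simp
  then have nM: "n \<le> M ^ 2" by (simp only: of_nat_le_iff)
  define Z1 where "Z1 = {x \<in> Z. x \<le> 1 - 1 / real M}"
  define Z2 where "Z2 = {x \<in> Z. 1 - 1 / real M \<le> x}"
  have fin12: "finite Z1" "finite Z2" using fin by (simp_all add: Z1_def Z2_def)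
  have "card Z1 \<le> 6 * M"
    by (rule card_zeros_away_from_1[OF co c0 M0 fin12(1)]) (auto simp: Z1_def Z_def)
  moreover have "card Z2 \<le> 58 * M"
    by (rule card_zeros_near_1[OF n(1) nM co c0 M0 fin12(2)]) (auto simp: Z2_def Z_def)
  moreover have "Z = Z1 \<union> Z2" by (auto simp: Z1_def Z2_def)
  then have "card Z \<le> card Z1 + card Z2" by (simp add: card_Un_le)
  ultimately have "card Z \<le> 64 * M" by linarith
  then have "real (card Z) \<le> 64 * real M" by linarith
  then show "real (card Z) \<le> 128 * sqrt (real n)" using M(2) s1 by linarith
qed

section \<open>From the unit interval to rays and the plane\<close>

text \<open>The constant coefficient of \<open>reflect_poly f\<close> is
  \<open>lead_coeff f\<close>, so the unit interval bound applies to both polynomials, which doubles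
  the constant.\<close>

lemma card_zeros_positive_axis:
  fixes f :: "complex poly"
  assumes n: "degree f = n" "n > 0"
    and co: "\<And>k. norm (coeff f k) \<le> 2" and c0: "norm (coeff f 0) \<ge> 1" and cn: "norm (lead_coeff f) \<ge> 1"
  defines "Z \<equiv> {x::real. 0 < x \<and> poly f (of_real x) = 0}"
  shows "finite Z" "real (card Z) \<le> 256 * sqrt (real n)"
proof -
  define Z1 where "Z1 = {x::real. 0 < x \<and> x \<le> 1 \<and> poly f (of_real x) = 0}"
  define Z2 where "Z2 = {x::real. 0 < x \<and> x \<le> 1 \<and> poly (reflect_poly f) (of_real x) = 0}"
  have 1: "finite Z1" "real (card Z1) \<le> 128 * sqrt (real n)"
    unfolding Z1_def using card_zeros_unit_interval[of f n] n co c0 by auto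
  have co2: "norm (coeff (reflect_poly f) k) \<le> 2" for k
    using co by (simp add: coeff_reflect_poly)
  have 2: "finite Z2" "real (card Z2) \<le> 128 * sqrt (real n)"
    unfolding Z2_def using card_zeros_unit_interval[of "reflect_poly f" n] n co2 cn degree_reflect_poly_le[of f] by auto
  have sub: "Z \<subseteq> Z1 \<union> inverse ` Z2"
  proof
    fix x assume x: "x \<in> Z"
    show "x \<in> Z1 \<union> inverse ` Z2"
    proof (cases "x \<le> 1")
      case True then show ?thesis using x by (auto simp: Z_def Z1_def)
    next
      case False
      then have "inverse x \<in> Z2" using x
        by (auto simp: Z_def Z2_def poly_reflect_poly_nz inverse_le_1_iff)
      then show ?thesis by (metis UnI2 image_eqI inverse_inverse_eq)
    qed
  qed
  then show "finite Z" using 1 2 by (meson finite_UnI finite_imageI finite_subset)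
  have "card Z \<le> card (Z1 \<union> inverse ` Z2)" using sub 1 2 by (intro card_mono) auto
  also have "\<dots> \<le> card Z1 + card (inverse ` Z2)" by (rule card_Un_le)
  also have "card (inverse ` Z2) \<le> card Z2" using 2 by (intro card_image_le)
  finally show "real (card Z) \<le> 256 * sqrt (real n)" using 1 2 by linarith
qed

text \<open>For real \<open>x\<close> the conjugate of \<open>c k * (\<omega> * x) ^ k\<close> is
  again a constant times \<open>x ^ k\<close>, so on the ray the equation is polynomial in
  \<open>x\<close>. As \<open>m < n\<close>, its leading coefficient is \<open>\<omega> ^ n\<close>,
  of modulus 1; its constant coefficient is 2 because \<open>c 0 = 1\<close>.\<close>

lemma card_zeros_on_ray:
  fixes c :: "nat \<Rightarrow> complex"
  assumes mn: "m < n" and c: "\<And>k. k \<le> m \<Longrightarrow> norm (c k) = 1" and c0: "c 0 = 1"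
    and \<omega>: "norm \<omega> = 1"
  defines "q \<equiv> \<lambda>z. \<Sum>k\<le>m. c k * z ^ k"
  defines "Z \<equiv> {x::real. 0 < x \<and> (\<omega> * of_real x) ^ n + q (\<omega> * of_real x) + cnj (q (\<omega> * of_real x)) = 0}"
  shows "finite Z" "real (card Z) \<le> 256 * sqrt (real n)"
proof -
  define a where "a = (\<lambda>k. if k = n then \<omega> ^ n
    else if k \<le> m then complex_of_real (2 * Re (c k * \<omega> ^ k)) else 0)"
  define f where "f = (\<Sum>k\<le>n. monom (a k) k)"
  have cf: "coeff f k = (if k \<le> n then a k else 0)" for k
    by (simp add: f_def coeff_sum coeff_monom)
  have an: "norm (a n) = 1" using \<omega> by (simp add: a_def norm_power)
  have "degree f = n"
  proof (rule antisym)
    show "degree f \<le> n" by (rule degree_le) (auto simp: cf)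
    show "n \<le> degree f" using an by (intro le_degree) (auto simp: cf)
  qed
  have pf: "poly f (of_real x) = (\<omega> * of_real x) ^ n + q (\<omega> * of_real x) + cnj (q (\<omega> * of_real x))" for x
  proof -
    have "poly f (of_real x) = (\<Sum>k\<le>n. a k * of_real x ^ k)"
      by (simp add: f_def poly_sum poly_monom)
    also have "\<dots> = a n * of_real x ^ n + (\<Sum>k<n. a k * of_real x ^ k)"
      by (simp add: lessThan_Suc_atMost[symmetric])
    also have "(\<Sum>k<n. a k * of_real x ^ k) = (\<Sum>k\<le>m. a k * of_real x ^ k)"
      using mn by (intro sum.mono_neutral_right) (auto simp: a_def)
    also have "\<dots> = (\<Sum>k\<le>m. c k * (\<omega> * of_real x) ^ k + cnj (c k * (\<omega> * of_real x) ^ k))"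
    proof (rule sum.cong)
      fix k assume "k \<in> {..m}"
      then have "a k = c k * \<omega> ^ k + cnj (c k * \<omega> ^ k)"
        using mn by (simp only: complex_add_cnj) (simp add: a_def)
      then show "a k * of_real x ^ k = c k * (\<omega> * of_real x) ^ k + cnj (c k * (\<omega> * of_real x) ^ k)"
        by (simp add: power_mult_distrib algebra_simps)
    qed simp
    finally show ?thesis by (simp add: a_def q_def power_mult_distrib sum.distrib)
  qed
  have Z: "Z = {x. 0 < x \<and> poly f (of_real x) = 0}" by (simp add: Z_def pf)
  have co: "norm (coeff f k) \<le> 2" for k
  proof -
    have "\<bar>Re (c k * \<omega> ^ k)\<bar> \<le> 1" if "k \<le> m"
      using abs_Re_le_cmod[of "c k * \<omega> ^ k"] c[OF that] \<omega> by (simp add: norm_mult norm_power)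
    then have "norm (complex_of_real (2 * Re (c k * \<omega> ^ k))) \<le> 2" if "k \<le> m"
      unfolding norm_of_real using that by (simp add: abs_mult)
    then show ?thesis using an unfolding cf a_def by auto
  qed
  show "finite Z" "real (card Z) \<le> 256 * sqrt (real n)"
    unfolding Z using card_zeros_positive_axis[of f n] co an mn \<open>degree f = n\<close>
    by (auto simp: cf a_def c0)
qed

theorem theorem1p8:
  shows "\<exists>C::real. C > 0 \<and>
    (\<forall>(n::nat) (m::nat) (c::nat \<Rightarrow> complex).
       1 \<le> m \<longrightarrow> m < n \<longrightarrow>
       (\<forall>k\<le>m. norm (c k) = 1) \<longrightarrow> c 0 = 1 \<longrightarrow>
       (let q = (\<lambda>z. \<Sum>k\<le>m. c k * z ^ k);
            Z = {z::complex. z ^ n + q z + cnj (q z) = 0}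
        in finite Z \<and> real (card Z) \<le> C * real n powr (3/2)))"
proof (intro exI[of _ 512] conjI allI impI)
  fix n m :: nat and c :: "nat \<Rightarrow> complex"
  assume mn: "1 \<le> m" "m < n" and c: "\<forall>k\<le>m. norm (c k) = 1" "c 0 = 1"
  define q where "q = (\<lambda>z. \<Sum>k\<le>m. c k * z ^ k)"
  define Z where "Z = {z::complex. z ^ n + q z + cnj (q z) = 0}"
  define W where "W = {\<omega>::complex. \<omega> ^ (2 * n) = 1}"
  define X where "X = (\<lambda>\<omega>. {x::real. 0 < x \<and>
    (\<omega> * of_real x) ^ n + q (\<omega> * of_real x) + cnj (q (\<omega> * of_real x)) = 0})"
  have W: "finite W" "card W = 2 * n"
    using mn finite_roots_unity[of "2 * n"] card_roots_unity_eq[of "2 * n"] by (auto simp: W_def)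
  have X: "finite (X \<omega>)" "real (card (X \<omega>)) \<le> 256 * sqrt (real n)" if "\<omega> \<in> W" for \<omega>
  proof -
    have "norm \<omega> ^ (2 * n) = 1" using that by (simp add: W_def flip: norm_power)
    then have "norm \<omega> = 1" using mn power_eq_1_iff[of "norm \<omega>" "2 * n"] by auto
    then show "finite (X \<omega>)" "real (card (X \<omega>)) \<le> 256 * sqrt (real n)"
      unfolding X_def q_def using card_zeros_on_ray[of m n c \<omega>] mn c by auto
  qed
  have sub: "Z \<subseteq> (\<Union>\<omega>\<in>W. (\<lambda>x. \<omega> * of_real x) ` X \<omega>)"
  proof
    fix z assume z: "z \<in> Z"
    \<comment> \<open>The origin lies on no open ray, but it is not a zero: the value there is
      \<open>0 + 1 + 1\<close>.\<close>
    have "q 0 = 1" using c by (simp add: q_def power_0_left if_distrib cong: if_cong)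
    then have z0: "z \<noteq> 0" using z mn by (auto simp: Z_def power_0_left)
    define y where "y = - (2 * Re (q z))"
    have "z ^ n + (q z + cnj (q z)) = 0" using z by (simp add: Z_def add.assoc)
    then have zn: "z ^ n = of_real y" by (simp add: complex_add_cnj y_def add_eq_0_iff2)
    \<comment> \<open>Since \<open>z ^ n\<close> is real, its square equals the square of its
      modulus.\<close>
    have "sgn z ^ (2 * n) = (z ^ n) ^ 2 / of_real (norm (z ^ n) ^ 2)"
      by (simp add: sgn_eq power_divide norm_power power_mult[symmetric] mult.commute)
    also have "\<dots> = 1" using z0 zn by (simp add: flip: of_real_power) (metis power_eq_0_iff of_real_eq_0_iff)
    finally have "sgn z \<in> W" by (simp add: W_def)
    moreover have zz: "z = sgn z * of_real (norm z)" using z0 by (simp add: sgn_eq)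
    moreover have "norm z \<in> X (sgn z)" using z z0 zz by (simp add: X_def Z_def flip: zz)
    ultimately show "z \<in> (\<Union>\<omega>\<in>W. (\<lambda>x. \<omega> * of_real x) ` X \<omega>)" by blast
  qed
  have finU: "finite (\<Union>\<omega>\<in>W. (\<lambda>x. \<omega> * of_real x) ` X \<omega>)" using W X by auto
  have "card Z \<le> card (\<Union>\<omega>\<in>W. (\<lambda>x. \<omega> * of_real x) ` X \<omega>)" using sub finU by (rule card_mono[rotated])
  also have "\<dots> \<le> (\<Sum>\<omega>\<in>W. card ((\<lambda>x. \<omega> * of_real x) ` X \<omega>))" using W by (intro card_UN_le)
  also have "\<dots> \<le> (\<Sum>\<omega>\<in>W. card (X \<omega>))" using X by (intro sum_mono card_image_le)
  finally have "real (card Z) \<le> (\<Sum>\<omega>\<in>W. real (card (X \<omega>)))"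
    by (metis of_nat_le_iff of_nat_sum)
  also have "\<dots> \<le> (\<Sum>\<omega>\<in>W. 256 * sqrt (real n))" using X by (intro sum_mono)
  \<comment> \<open>\<open>2 * n\<close> rays with at most \<open>256 * sqrt n\<close> zeros
    each.\<close>
  also have "\<dots> = 512 * (real n * sqrt (real n))" using W by simp
  also have "real n * sqrt (real n) = real n powr (1 + 1/2)"
    using mn by (subst powr_add) (simp add: powr_half_sqrt)
  finally have "real (card Z) \<le> 512 * real n powr (3/2)" by simp
  moreover have "finite Z" using sub finU by (rule finite_subset)
  ultimately show "let q = (\<lambda>z. \<Sum>k\<le>m. c k * z ^ k);
            Z = {z::complex. z ^ n + q z + cnj (q z) = 0}
        in finite Z \<and> real (card Z) \<le> 512 * real n powr (3/2)"
    by (simp add: Let_def Z_def q_def)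
qed simp

end
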